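(* Let $G$ be a group, $N=[G,G]$ its commutator subgroup, $\Gamma=G/N$ its abelianization and $p\colon G\to\Gamma$ the quotient map. Let $\mu\in Q(N)^G$. Then there exists an alternating $\mathbb{Z}$-bilinear form $\mathfrak{b}_\mu\colon\Gamma\times\Gamma\to\mathbb{R}$ such that for all $g_1,g_2\in G$, $$\big|\mu([g_1,g_2])-\mathfrak{b}_\mu(p(g_1),p(g_2))\big|\le D(\mu).$$
   Context: A quasimorphism on a group $N$ is a function $\mu\colon N\to\mathbb{R}$ with finite defect $D(\mu)=\sup_{x,y\in N}|\mu(xy)-\mu(x)-\mu(y)|$; it is homogeneous if $\mu(x^k)=k\mu(x)$ for all $x\in N$, $k\in\mathbb{Z}$. For a normal subgroup $N$ of $G$, $Q(N)^G$ is the $\mathbb{R}$-linear space of homogeneous quasimorphisms $\mu$ on $N$ with $\mu(gxg^{-1})=\mu(x)$ for all $g\in G$, $x\in N$. An ($\mathbb{R}$-valued) alternating $\mathbb{Z}$-bilinear form on an abelian group $\Gamma$ (written additively) is a map $\mathfrak{b}\colon\Gamma\times\Gamma\to\mathbb{R}$ with $\mathfrak{b}(\gamma_1+\gamma_2,\gamma)=\mathfrak{b}(\gamma_1,\gamma)+\mathfrak{b}(\gamma_2,\gamma)$ and $\mathfrak{b}(\gamma_2,\gamma_1)=-\mathfrak{b}(\gamma_1,\gamma_2)$. Commutators: $[g_1,g_2]=g_1g_2g_1^{-1}g_2^{-1}$. *)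

theory Defs
  imports Complex_Main "HOL-Algebra.Algebra"
begin

definition group_commutator :: "('a, 'm) monoid_scheme \<Rightarrow> 'a \<Rightarrow> 'a \<Rightarrow> 'a" where
  "group_commutator G x y =
     x \<otimes>\<^bsub>G\<^esub> y \<otimes>\<^bsub>G\<^esub> inv\<^bsub>G\<^esub> x \<otimes>\<^bsub>G\<^esub> inv\<^bsub>G\<^esub> y"

text \<open>A function on a group is a total function on the underlying type; only its values
  on the carrier are relevant.\<close>

definition defect_set :: "('a, 'm) monoid_scheme \<Rightarrow> ('a \<Rightarrow> real) \<Rightarrow> real set" where
  "defect_set H \<mu> =
     (\<lambda>(x, y). \<bar>\<mu> (x \<otimes>\<^bsub>H\<^esub> y) - \<mu> x - \<mu> y\<bar>) ` (carrier H \<times> carrier H)"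

text \<open>The supremum is a real number, hence meaningful only if the set is bounded above,
  which is the defining condition of a quasimorphism.\<close>

definition defect :: "('a, 'm) monoid_scheme \<Rightarrow> ('a \<Rightarrow> real) \<Rightarrow> real" where
  "defect H \<mu> = Sup (defect_set H \<mu>)"

definition quasimorphism :: "('a, 'm) monoid_scheme \<Rightarrow> ('a \<Rightarrow> real) \<Rightarrow> bool" where
  "quasimorphism H \<mu> \<longleftrightarrow> bdd_above (defect_set H \<mu>)"

definition homogeneous :: "('a, 'm) monoid_scheme \<Rightarrow> ('a \<Rightarrow> real) \<Rightarrow> bool" where
  "homogeneous H \<mu> \<longleftrightarrow>
     (\<forall>x\<in>carrier H. \<forall>k::int. \<mu> (x [^]\<^bsub>H\<^esub> k) = of_int k * \<mu> x)"

text \<open>The space \<open>Q(N)\<^sup>G\<close>, for a normal subgroup \<open>N\<close> of \<open>G\<close>.\<close>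

definition invariant_quasimorphisms ::
    "('a, 'm) monoid_scheme \<Rightarrow> 'a set \<Rightarrow> ('a \<Rightarrow> real) set" where
  "invariant_quasimorphisms G N =
     {\<mu>. quasimorphism (G\<lparr>carrier := N\<rparr>) \<mu> \<and> homogeneous (G\<lparr>carrier := N\<rparr>) \<mu> \<and>
         (\<forall>g\<in>carrier G. \<forall>x\<in>N. \<mu> (g \<otimes>\<^bsub>G\<^esub> x \<otimes>\<^bsub>G\<^esub> inv\<^bsub>G\<^esub> g) = \<mu> x)}"

text \<open>The abelian group \<open>A\<close> is written multiplicatively. Additivity in the second
  argument follows from the two conditions.\<close>

definition alternating_bilinear_form ::
    "('b, 'm) monoid_scheme \<Rightarrow> ('b \<Rightarrow> 'b \<Rightarrow> real) \<Rightarrow> bool" where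
  "alternating_bilinear_form A b \<longleftrightarrow>
     (\<forall>x\<in>carrier A. \<forall>y\<in>carrier A. \<forall>z\<in>carrier A. b (x \<otimes>\<^bsub>A\<^esub> y) z = b x z + b y z) \<and>
     (\<forall>x\<in>carrier A. \<forall>y\<in>carrier A. b y x = - b x y)"

end

theory Submission
  imports Defs
begin

text \<open>Since \<open>[gg', h] = g[g', h]g\<inverse> [g, h]\<close> and \<open>\<mu>\<close> is \<open>G\<close>-invariant, for fixed \<open>h\<close> the function
  \<open>f(g) = \<mu>([g, h])\<close> is a quasimorphism on \<open>G\<close> with defect at most \<open>D(\<mu>)\<close>; as
  \<open>[n, h] = n \<cdot> hn\<inverse>h\<inverse>\<close> and \<open>\<mu>(hn\<inverse>h\<inverse>) = -\<mu>(n)\<close>, it is bounded on \<open>N\<close>. The homogenization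
  \<open>b(\<cdot>, h)\<close> of such a function is a homomorphism, because \<open>(xy)\<^sup>k\<close> and \<open>x\<^sup>k y\<^sup>k\<close> differ by an
  element of \<open>N\<close>, and it stays within \<open>D(\<mu>)\<close> of \<open>f\<close>. Finally \<open>b(g, hk) - b(g, h) - b(g, k)\<close>,
  \<open>b(g, h) + b(h, g)\<close> and the restriction of \<open>b(\<cdot>, h)\<close> to \<open>N\<close> are bounded homomorphisms in one
  of the variables, hence vanish.\<close>

text \<open>Additivity forces \<open>h\<close> to grow linearly along the powers of
  \<open>x\<close>, which contradicts the bound unless the slope \<open>h x\<close> is zero. The
  subgroup \<open>K\<close> is a parameter because the fact is applied both to the whole group and
  to the commutator subgroup.\<close>

lemma (in group) bounded_additive_eq_0:
  fixes h :: "'a \<Rightarrow> real"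
  assumes "subgroup K G"
    and add: "\<And>x y. x \<in> K \<Longrightarrow> y \<in> K \<Longrightarrow> h (x \<otimes> y) = h x + h y"
    and bdd: "\<And>x. x \<in> K \<Longrightarrow> \<bar>h x\<bar> \<le> C"
    and x: "x \<in> K"
  shows "h x = 0"
proof -
  interpret K: subgroup K G by fact
  have pow: "x [^] (n::nat) \<in> K" for n
    by (induction n) (use x in auto)
  have "h \<one> = 0"
    using add[OF K.one_closed K.one_closed] by simp
  then have hpow: "h (x [^] n) = real n * h x" for n :: nat
    by (induction n) (simp_all add: add pow x algebra_simps)
  have le: "real n * \<bar>h x\<bar> \<le> C" for n :: nat
    using bdd[OF pow[of n]] by (simp add: hpow abs_mult)
  show ?thesis
  proof (rule ccontr)
    assume "h x \<noteq> 0"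
    then obtain n :: nat where "C < real n * \<bar>h x\<bar>"
      using reals_Archimedean3[of "\<bar>h x\<bar>"] by auto
    with le[of n] show False by simp
  qed
qed

text \<open>Powers distribute over products in the abelian quotient, so the two sides lie in the
  same right coset; \<open>c\<close> is the resulting left factor.\<close>

lemma (in group) pow_mult_derived:
  fixes n :: nat
  assumes x: "x \<in> carrier G" and y: "y \<in> carrier G"
  shows "\<exists>c \<in> derived G (carrier G). (x \<otimes> y) [^] n = c \<otimes> (x [^] n \<otimes> y [^] n)"
proof -
  let ?N = "derived G (carrier G)"
  interpret N: normal ?N G by (rule derived_self_is_normal)
  interpret Q: comm_group "G Mod ?N" by (rule derived_quot_is_comm_group)
  have Q: "?N #> z \<in> carrier (G Mod ?N)" if "z \<in> carrier G" for z
    using that by (simp add: carrier_FactGroup)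
  have "?N #> (x \<otimes> y) [^] n = (?N #> (x \<otimes> y)) [^]\<^bsub>G Mod ?N\<^esub> n"
    using x y by (simp add: N.FactGroup_pow)
  also have "?N #> (x \<otimes> y) = (?N #> x) \<otimes>\<^bsub>G Mod ?N\<^esub> (?N #> y)"
    using x y by (simp add: N.rcos_sum)
  also have "(\<dots>) [^]\<^bsub>G Mod ?N\<^esub> n
      = (?N #> x) [^]\<^bsub>G Mod ?N\<^esub> n \<otimes>\<^bsub>G Mod ?N\<^esub> (?N #> y) [^]\<^bsub>G Mod ?N\<^esub> n"
    by (rule Q.nat_pow_distrib[OF Q[OF x] Q[OF y]])
  also have "\<dots> = ?N #> (x [^] n \<otimes> y [^] n)"
    using x y by (simp add: N.FactGroup_pow N.rcos_sum)
  finally have "?N #> (x \<otimes> y) [^] n = ?N #> (x [^] n \<otimes> y [^] n)" .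
  then have "(x \<otimes> y) [^] n \<in> ?N #> (x [^] n \<otimes> y [^] n)"
    using rcos_self[OF _ N.subgroup_axioms, of "(x \<otimes> y) [^] n"] x y by simp
  then show ?thesis
    by (auto simp: r_coset_def)
qed

text \<open>The homomorphism is the homogenization, computed along powers of two as in Hyers' theorem.\<close>

lemma (in group) quasimorphism_bounded_on_derived_near_hom:
  fixes f :: "'a \<Rightarrow> real"
  assumes quasi: "\<And>x y. x \<in> carrier G \<Longrightarrow> y \<in> carrier G \<Longrightarrow> \<bar>f (x \<otimes> y) - f x - f y\<bar> \<le> D"
    and bdd: "\<And>c. c \<in> derived G (carrier G) \<Longrightarrow> \<bar>f c\<bar> \<le> C"
  shows "\<exists>b. (\<forall>x\<in>carrier G. \<forall>y\<in>carrier G. b (x \<otimes> y) = b x + b y) \<and>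
             (\<forall>x\<in>carrier G. \<bar>b x - f x\<bar> \<le> D)"
proof -
  have D: "D \<ge> 0"
    using quasi[OF one_closed one_closed] by linarith
  define a where "a n x = f (x [^] (2 ^ n :: nat)) / 2 ^ n" for n x
  have step: "\<bar>a (Suc n) x - a n x\<bar> \<le> D / 2 ^ Suc n" if "x \<in> carrier G" for n x
  proof -
    let ?y = "x [^] (2 ^ n :: nat)"
    have "x [^] (2 ^ Suc n :: nat) = ?y \<otimes> ?y"
      using that by (simp add: nat_pow_mult mult_2)
    then have "a (Suc n) x - a n x = (f (?y \<otimes> ?y) - f ?y - f ?y) / 2 ^ Suc n"
      by (simp add: a_def field_simps)
    then show ?thesis
      using quasi[of ?y ?y] that by (simp add: divide_right_mono)
  qed
  \<comment> \<open>The right side is the exact value of the geometric sum of the bounds in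
    \<open>step\<close>, so the induction closes; its last term is dropped afterwards using
    \<open>D \<ge> 0\<close>.\<close>
  have "\<bar>a (n + k) x - a n x\<bar> \<le> D / 2 ^ n - D / 2 ^ (n + k)" if "x \<in> carrier G" for n k x
  proof (induction k)
    case (Suc k)
    have "D / 2 ^ (n + k) = D / 2 ^ Suc (n + k) + D / 2 ^ Suc (n + k)"
      by simp
    then show ?case
      using Suc step[OF that, of "n + k"] unfolding add_Suc_right by linarith
  qed simp
  moreover have "D / 2 ^ (n + k) \<ge> 0" for n k :: nat
    using D by simp
  ultimately have near: "\<bar>a (n + k) x - a n x\<bar> \<le> D / 2 ^ n" if "x \<in> carrier G" for n k x
    using that by (smt (verit))
  have null: "(\<lambda>n. K / 2 ^ n) \<longlonglongrightarrow> 0" for K :: real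
    using tendsto_mult_right_zero[OF LIMSEQ_inverse_realpow_zero[of 2], of K]
    by (simp add: divide_inverse)
  define b where "b x = lim (\<lambda>n. a n x)" for x
  have lim: "(\<lambda>n. a n x) \<longlonglongrightarrow> b x" if "x \<in> carrier G" for x
  proof -
    have "Cauchy (\<lambda>n. a n x)"
    proof (rule metric_CauchyI)
      fix e :: real
      assume "e > 0"
      then obtain M where M: "D / 2 ^ M < e / 2"
        using order_tendstoD(2)[OF null, of "e / 2" D] by (auto simp: eventually_sequentially)
      have "dist (a n x) (a M x) < e / 2" if "n \<ge> M" for n
        using near[OF \<open>x \<in> carrier G\<close>, of M "n - M"] M
        unfolding dist_real_def le_add_diff_inverse[OF that] by linarith
      then show "\<exists>M. \<forall>m\<ge>M. \<forall>n\<ge>M. dist (a m x) (a n x) < e"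
        by (meson dist_triangle_half_l)
    qed
    then show ?thesis
      unfolding b_def by (simp add: Cauchy_convergent convergent_LIMSEQ_iff[symmetric])
  qed
  have "\<bar>b x - f x\<bar> \<le> D" if "x \<in> carrier G" for x
  proof (rule LIMSEQ_le_const2)
    show "(\<lambda>n. \<bar>a n x - f x\<bar>) \<longlonglongrightarrow> \<bar>b x - f x\<bar>"
      by (intro tendsto_intros lim that)
    \<comment> \<open>Comparing with index 0, where \<open>a 0 x = f x\<close>, gives exactly
      \<open>D\<close> with no further loss.\<close>
    show "\<exists>M. \<forall>n\<ge>M. \<bar>a n x - f x\<bar> \<le> D"
      using near[OF that, of 0] that by (simp add: a_def)
  qed
  moreover have "b (x \<otimes> y) = b x + b y" if x: "x \<in> carrier G" and y: "y \<in> carrier G" for x y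
  proof -
    \<comment> \<open>One \<open>D\<close> for splitting off \<open>c\<close>, one for splitting the
      product of the two powers, and \<open>C\<close> for the value of \<open>f\<close> at
      \<open>c\<close>.\<close>
    have bound: "\<bar>a n (x \<otimes> y) - a n x - a n y\<bar> \<le> (2 * D + C) / 2 ^ n" for n
    proof -
      let ?x = "x [^] (2 ^ n :: nat)" and ?y = "y [^] (2 ^ n :: nat)"
      obtain c where c: "c \<in> derived G (carrier G)"
        and eq: "(x \<otimes> y) [^] (2 ^ n :: nat) = c \<otimes> (?x \<otimes> ?y)"
        using pow_mult_derived[OF x y] by blast
      have "c \<in> carrier G"
        using c derived_in_carrier by auto
      then have "\<bar>f (c \<otimes> (?x \<otimes> ?y)) - f ?x - f ?y\<bar> \<le> 2 * D + C"
        using quasi[of c "?x \<otimes> ?y"] quasi[of ?x ?y] bdd[OF c] x y by simp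
      moreover have "a n (x \<otimes> y) - a n x - a n y = (f (c \<otimes> (?x \<otimes> ?y)) - f ?x - f ?y) / 2 ^ n"
        by (simp add: a_def eq diff_divide_distrib)
      ultimately show ?thesis
        by (simp add: divide_right_mono)
    qed
    have "(\<lambda>n. a n (x \<otimes> y) - a n x - a n y) \<longlonglongrightarrow> 0"
      using order_trans[OF bound abs_ge_self]
      by (intro tendsto_0_le[OF null[of "2 * D + C"], where K = 1] always_eventually) simp
    moreover have "(\<lambda>n. a n (x \<otimes> y) - a n x - a n y) \<longlonglongrightarrow> b (x \<otimes> y) - b x - b y"
      by (intro tendsto_intros lim x y m_closed)
    ultimately show ?thesis
      using LIMSEQ_unique by fastforce
  qed
  ultimately show ?thesis
    by blast
qed

text \<open>Nothing is assumed about how \<open>b\<close> depends on its second argument. Both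
  missing identities state that some error term vanishes; this term is additive in one variable, and
  it is bounded because \<open>f\<close> is alternating and close to \<open>b\<close>.\<close>

lemma (in group) near_alternating_imp_alternating:
  fixes b f :: "'a \<Rightarrow> 'a \<Rightarrow> real"
  assumes add: "\<And>x y z. x \<in> carrier G \<Longrightarrow> y \<in> carrier G \<Longrightarrow> z \<in> carrier G \<Longrightarrow>
      b (x \<otimes> y) z = b x z + b y z"
    and near: "\<And>x z. x \<in> carrier G \<Longrightarrow> z \<in> carrier G \<Longrightarrow> \<bar>b x z - f x z\<bar> \<le> D"
    and alt: "\<And>x z. x \<in> carrier G \<Longrightarrow> z \<in> carrier G \<Longrightarrow> f z x = - f x z"
    and quasi: "\<And>x y z. x \<in> carrier G \<Longrightarrow> y \<in> carrier G \<Longrightarrow> z \<in> carrier G \<Longrightarrow>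
      \<bar>f (x \<otimes> y) z - f x z - f y z\<bar> \<le> D"
    and x: "x \<in> carrier G" and z: "z \<in> carrier G"
  shows "b z x = - b x z"
proof -
  have add2: "b u (v \<otimes> w) = b u v + b u w"
    if u: "u \<in> carrier G" and v: "v \<in> carrier G" and w: "w \<in> carrier G" for u v w
  proof -
    have "b u (v \<otimes> w) - b u v - b u w = 0"
    proof (rule bounded_additive_eq_0[OF subgroup_self _ _ u])
      fix s
      assume s: "s \<in> carrier G"
      \<comment> \<open>Three \<open>D\<close> come from replacing \<open>b\<close> by
        \<open>f\<close>; the fourth is the defect of \<open>f\<close> in its first argument, moved
        to the second by \<open>alt\<close>.\<close>
      show "\<bar>b s (v \<otimes> w) - b s v - b s w\<bar> \<le> 4 * D"
        using near[OF s v] near[OF s w] near[of s "v \<otimes> w"] quasi[OF v w s]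
          alt[OF s v] alt[OF s w] alt[of s "v \<otimes> w"] s v w by simp
    qed (simp add: add v w)
    then show ?thesis by simp
  qed
  have "b x z + b z x = 0"
  proof (rule bounded_additive_eq_0[OF subgroup_self _ _ x])
    fix s
    assume s: "s \<in> carrier G"
    show "\<bar>b s z + b z s\<bar> \<le> 2 * D"
      using near[OF s z] near[OF z s] alt[OF s z] by simp
  qed (simp add: add add2 z)
  then show ?thesis by simp
qed

text \<open>By \<open>alt\<close>, vanishing on \<open>H\<close> in the first argument gives
  vanishing in the second, so \<open>b\<close> depends only on the cosets. The induced form is
  evaluated at chosen representatives.\<close>

lemma (in normal) alternating_form_FactGroup:
  fixes b :: "'a \<Rightarrow> 'a \<Rightarrow> real"
  assumes add: "\<And>x y z. x \<in> carrier G \<Longrightarrow> y \<in> carrier G \<Longrightarrow> z \<in> carrier G \<Longrightarrow>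
      b (x \<otimes> y) z = b x z + b y z"
    and alt: "\<And>x z. x \<in> carrier G \<Longrightarrow> z \<in> carrier G \<Longrightarrow> b z x = - b x z"
    and zero: "\<And>n z. n \<in> H \<Longrightarrow> z \<in> carrier G \<Longrightarrow> b n z = 0"
  shows "\<exists>b'. alternating_bilinear_form (G Mod H) b' \<and>
              (\<forall>x\<in>carrier G. \<forall>z\<in>carrier G. b' (H #> x) (H #> z) = b x z)"
proof -
  define b' where "b' A B = b (SOME x. x \<in> A) (SOME z. z \<in> B)" for A B
  have rep: "\<exists>n\<in>H. (SOME y. y \<in> H #> x) = n \<otimes> x" if "x \<in> carrier G" for x
  proof -
    have "(SOME y. y \<in> H #> x) \<in> H #> x"
      using rcos_self[OF that subgroup_axioms] by (rule someI)
    then show ?thesis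
      by (auto simp: r_coset_def)
  qed
  have b': "b' (H #> x) (H #> z) = b x z" if x: "x \<in> carrier G" and z: "z \<in> carrier G" for x z
  proof -
    obtain m n where m: "m \<in> H" "(SOME y. y \<in> H #> x) = m \<otimes> x"
      and n: "n \<in> H" "(SOME y. y \<in> H #> z) = n \<otimes> z"
      using rep[OF x] rep[OF z] by blast
    \<comment> \<open>The representatives are corrected one at a time; swapping the arguments brings
      the second one into the slot where \<open>add\<close> and \<open>zero\<close> apply.\<close>
    have "b (m \<otimes> x) (n \<otimes> z) = b x (n \<otimes> z)"
      using m n x z by (simp add: add zero)
    also have "\<dots> = - b (n \<otimes> z) x"
      using n x z by (intro alt) auto
    also have "\<dots> = b x z"
      using n x z alt[OF x z] by (simp add: add zero)
    finally show ?thesis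
      by (simp add: b'_def m n)
  qed
  have "alternating_bilinear_form (G Mod H) b'"
    unfolding alternating_bilinear_form_def
    by (auto simp: carrier_FactGroup rcos_sum b' add intro: alt)
  with b' show ?thesis by blast
qed

lemma invariant_quasimorphisms_properties:
  fixes G :: "('a, 'm) monoid_scheme" (structure)
  assumes "group G" and "subgroup N G" and "\<mu> \<in> invariant_quasimorphisms G N"
  shows "\<And>x y. x \<in> N \<Longrightarrow> y \<in> N \<Longrightarrow> \<bar>\<mu> (x \<otimes> y) - \<mu> x - \<mu> y\<bar> \<le> defect (G\<lparr>carrier := N\<rparr>) \<mu>"
    and "\<And>x. x \<in> N \<Longrightarrow> \<mu> (inv x) = - \<mu> x"
    and "\<And>g x. g \<in> carrier G \<Longrightarrow> x \<in> N \<Longrightarrow> \<mu> (g \<otimes> x \<otimes> inv g) = \<mu> x"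
proof -
  interpret group G by fact
  interpret H: group "G\<lparr>carrier := N\<rparr>" by (rule subgroup_imp_group[OF assms(2)])
  have q: "quasimorphism (G\<lparr>carrier := N\<rparr>) \<mu>" and h: "homogeneous (G\<lparr>carrier := N\<rparr>) \<mu>"
    and i: "\<And>g x. g \<in> carrier G \<Longrightarrow> x \<in> N \<Longrightarrow> \<mu> (g \<otimes> x \<otimes> inv g) = \<mu> x"
    using assms(3) by (auto simp: invariant_quasimorphisms_def)
  show "\<bar>\<mu> (x \<otimes> y) - \<mu> x - \<mu> y\<bar> \<le> defect (G\<lparr>carrier := N\<rparr>) \<mu>" if "x \<in> N" "y \<in> N" for x y
  proof -
    have "\<bar>\<mu> (x \<otimes> y) - \<mu> x - \<mu> y\<bar> \<in> defect_set (G\<lparr>carrier := N\<rparr>) \<mu>"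
      using that by (force simp: defect_set_def)
    then show ?thesis
      using q unfolding defect_def quasimorphism_def by (rule cSup_upper)
  qed
  show "\<mu> (inv x) = - \<mu> x" if x: "x \<in> N" for x
  proof -
    have "\<mu> (x [^]\<^bsub>G\<lparr>carrier := N\<rparr>\<^esub> (-1::int)) = of_int (-1) * \<mu> x"
      by (rule h[unfolded homogeneous_def, rule_format]) (simp add: x)
    \<comment> \<open>Homogeneity speaks of powers in the group restricted to \<open>N\<close>, so
      its inverse has to be identified with that of \<open>G\<close>.\<close>
    moreover have "x [^]\<^bsub>G\<lparr>carrier := N\<rparr>\<^esub> (-1::int) = inv x"
      using H.int_pow_neg[of x 1] H.int_pow_1[of x] x m_inv_consistent[OF assms(2) x] by simp
    ultimately show ?thesis by simp
  qed
  show "\<And>g x. g \<in> carrier G \<Longrightarrow> x \<in> N \<Longrightarrow> \<mu> (g \<otimes> x \<otimes> inv g) = \<mu> x"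
    by (rule i)
qed

theorem theorem4p2:
  fixes G :: "('a, 'm) monoid_scheme" and N :: "'a set" and \<mu> :: "'a \<Rightarrow> real"
  assumes "group G"
    and "N = derived G (carrier G)"
    and "\<mu> \<in> invariant_quasimorphisms G N"
  shows "\<exists>b :: 'a set \<Rightarrow> 'a set \<Rightarrow> real.
           alternating_bilinear_form (G Mod N) b \<and>
           (\<forall>g1\<in>carrier G. \<forall>g2\<in>carrier G.
              \<bar>\<mu> (group_commutator G g1 g2) - b (N #>\<^bsub>G\<^esub> g1) (N #>\<^bsub>G\<^esub> g2)\<bar>
                \<le> defect (G\<lparr>carrier := N\<rparr>) \<mu>)"
proof -
  interpret group G by fact
  interpret N: normal N G
    unfolding assms(2) by (rule derived_self_is_normal)
  define D where "D = defect (G\<lparr>carrier := N\<rparr>) \<mu>"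
  define f where "f g h = \<mu> (group_commutator G g h)" for g h
  note props = invariant_quasimorphisms_properties[OF assms(1) N.subgroup_axioms assms(3), folded D_def]
  have comm: "group_commutator G g h \<in> N" if "g \<in> carrier G" "h \<in> carrier G" for g h
    unfolding assms(2) derived_def group_commutator_def using that by (blast intro: generate.incl)
  have alt: "f h g = - f g h" if g: "g \<in> carrier G" and h: "h \<in> carrier G" for g h
  proof -
    have "group_commutator G h g = inv\<^bsub>G\<^esub> (group_commutator G g h)"
      using g h by (simp add: group_commutator_def inv_mult_group m_assoc)
    then show ?thesis
      using props(2)[OF comm[OF g h]] by (simp add: f_def)
  qed
  have quasi: "\<bar>f (x \<otimes>\<^bsub>G\<^esub> y) z - f x z - f y z\<bar> \<le> D"
    if x: "x \<in> carrier G" and y: "y \<in> carrier G" and z: "z \<in> carrier G" for x y z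
  proof -
    let ?c = "x \<otimes>\<^bsub>G\<^esub> group_commutator G y z \<otimes>\<^bsub>G\<^esub> inv\<^bsub>G\<^esub> x"
    \<comment> \<open>Once products are associated to the right, expanding the conjugate times the
      second commutator leaves two cancellations of this shape, first with \<open>x\<close> and then
      with \<open>z\<close>.\<close>
    have "inv\<^bsub>G\<^esub> u \<otimes>\<^bsub>G\<^esub> (u \<otimes>\<^bsub>G\<^esub> w) = w" if "u \<in> carrier G" "w \<in> carrier G" for u w
      using that by (simp flip: m_assoc)
    then have "group_commutator G (x \<otimes>\<^bsub>G\<^esub> y) z = ?c \<otimes>\<^bsub>G\<^esub> group_commutator G x z"
      using x y z by (simp add: group_commutator_def inv_mult_group m_assoc)
    then show ?thesis
      using props(1)[OF N.inv_op_closed2[OF x comm[OF y z]] comm[OF x z]]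
        props(3)[OF x comm[OF y z]] by (simp add: f_def)
  qed
  have bdd: "\<bar>f n z\<bar> \<le> D" if n: "n \<in> N" and z: "z \<in> carrier G" for n z
  proof -
    let ?c = "z \<otimes>\<^bsub>G\<^esub> inv\<^bsub>G\<^esub> n \<otimes>\<^bsub>G\<^esub> inv\<^bsub>G\<^esub> z"
    have "group_commutator G n z = n \<otimes>\<^bsub>G\<^esub> ?c"
      using n z by (simp add: group_commutator_def m_assoc)
    moreover have "\<mu> ?c = - \<mu> n"
      using props(2,3) n z by simp
    ultimately show ?thesis
      using props(1)[OF n N.inv_op_closed2[OF z N.m_inv_closed[OF n]]] by (simp add: f_def)
  qed
  have "\<exists>b. (\<forall>x\<in>carrier G. \<forall>y\<in>carrier G. b (x \<otimes>\<^bsub>G\<^esub> y) = b x + b y) \<and>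
            (\<forall>x\<in>carrier G. \<bar>b x - f x z\<bar> \<le> D)" if "z \<in> carrier G" for z
    by (rule quasimorphism_bounded_on_derived_near_hom) (use quasi bdd that assms(2) in auto)
  \<comment> \<open>The homomorphisms are chosen separately for each \<open>z\<close>, so
    \<open>b z x\<close> carries the second commutator entry first and has no known regularity in
    \<open>z\<close> yet.\<close>
  then obtain b where
    add: "\<And>x y z. x \<in> carrier G \<Longrightarrow> y \<in> carrier G \<Longrightarrow> z \<in> carrier G \<Longrightarrow>
      b z (x \<otimes>\<^bsub>G\<^esub> y) = b z x + b z y"
    and near: "\<And>x z. x \<in> carrier G \<Longrightarrow> z \<in> carrier G \<Longrightarrow> \<bar>b z x - f x z\<bar> \<le> D"
    by metis
  \<comment> \<open>On \<open>N\<close> the function \<open>f\<close> is bounded by \<open>D\<close>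
    and \<open>b\<close> differs from it by at most \<open>D\<close>.\<close>
  have "b z n = 0" if n: "n \<in> N" and z: "z \<in> carrier G" for n z
  proof (rule bounded_additive_eq_0[OF N.subgroup_axioms _ _ n])
    fix m
    assume "m \<in> N"
    then show "\<bar>b z m\<bar> \<le> 2 * D"
      using near[of m z] bdd[of m z] z by simp
  qed (simp add: add z)
  moreover have "b x z = - b z x" if "x \<in> carrier G" "z \<in> carrier G" for x z
    by (rule near_alternating_imp_alternating[where b = "\<lambda>x z. b z x" and f = f and D = D])
      (fact add near alt quasi that)+
  ultimately obtain b' where "alternating_bilinear_form (G Mod N) b'"
    and b': "\<forall>x\<in>carrier G. \<forall>z\<in>carrier G. b' (N #>\<^bsub>G\<^esub> x) (N #>\<^bsub>G\<^esub> z) = b z x"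
    using N.alternating_form_FactGroup[of "\<lambda>x z. b z x"] add by blast
  moreover have "\<bar>\<mu> (group_commutator G x z) - b' (N #>\<^bsub>G\<^esub> x) (N #>\<^bsub>G\<^esub> z)\<bar> \<le> D"
    if "x \<in> carrier G" "z \<in> carrier G" for x z
    using near[OF that] b' that by (simp add: f_def abs_minus_commute)
  ultimately show ?thesis
    unfolding D_def by blast
qed

end
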